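(* Let $J\ge1$, let $\lambda_i>0$, $\mu_i>0$, $z_i>0$ for $i=1,\dots,J$, and let $G=\{x\in\mathbb R^J:0\le x_i<z_i,\ i=1,\dots,J\}$. Consider the single-server network in which one server serves all $J$ classes and each customer requires service once, with the PDE (P) of the context. If $c$ is large enough, then there are constants $\alpha_i>0$, $i=1,\dots,J$, depending on $c$, such that the viscosity solution of (P) (for every sufficiently large bound $b<\infty$ on the perturbed rates, how large being allowed to depend on $c$) is $$V(x)=\min_{1\le i\le J}\alpha_i(z_i-x_i).$$
   Context: Let $U=\{u\in\mathbb R_+^J:\sum_{i=1}^Ju_i\le1\}$, $M^b=[0,b]^{2J}$ with elements $m=(\bar\lambda_1,\dots,\bar\lambda_J,\bar\mu_1,\dots,\bar\mu_J)$, $l(x)=x\log x-x+1$ for $x\ge0$ (with $0\log0=0$), and for $p\in\mathbb R^J$ $$H(p)=\inf_{m\in M^b}\sup_{u\in U}\Big\{c+\sum_{i=1}^J\Big[p_i(\bar\lambda_i-u_i\bar\mu_i)+\lambda_i\,l(\bar\lambda_i/\lambda_i)+u_i\mu_i\,l(\bar\mu_i/\mu_i)\Big]\Big\}.$$ Let $\gamma_i=e_i$ (the $i$-th unit vector), $I(x)=\{i:x_i=0\}$, $\partial_oG=\partial G\setminus G$, $\partial_+G=G\cap\partial\mathbb R_+^J$, $G^o=G\setminus\partial G$. The PDE is $$H(DV(x))=0,\ x\in G^o;\qquad\langle DV(x),\gamma_i\rangle=0,\ i\in I(x),\ x\in\partial_+G;\qquad V(x)=0,\ x\in\partial_oG.\tag{P}$$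 A Lipschitz function $V:G\to\mathbb R$ (extended continuously to $\bar G$) is a viscosity solution of (P) if $V=0$ on $\partial_oG$ and, for every $\theta$ continuously differentiable on $\bar G$ and $y\in G$: if $y$ is a local maximum of $V-\theta$ on $G$ then $H(D\theta(y))\vee\max_{i\in I(y)}\langle D\theta(y),\gamma_i\rangle\ge0$; if $y$ is a local minimum of $V-\theta$ on $G$ then $H(D\theta(y))\wedge\min_{i\in I(y)}\langle D\theta(y),\gamma_i\rangle\le0$ (max over the empty set is $-\infty$, min over the empty set is $+\infty$). *)

theory Defs
  imports "HOL-Analysis.Analysis"
begin

definition lfun :: "real \<Rightarrow> real" where
  "lfun x = x * ln x - x + 1"

definition U :: "(real ^ 'n::finite) set" where
  "U = {u. (\<forall>i. 0 \<le> u $ i) \<and> (\<Sum>i\<in>UNIV. u $ i) \<le> 1}"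

text \<open>The cube \<open>[0,b]\<^sup>2\<^sup>J\<close>, with \<open>m\<close> represented as the pair of its arrival rates and its
  service rates.\<close>

definition M :: "real \<Rightarrow> ((real ^ 'n::finite) \<times> (real ^ 'n)) set" where
  "M b = {(lb, mb). \<forall>i. 0 \<le> lb $ i \<and> lb $ i \<le> b \<and> 0 \<le> mb $ i \<and> mb $ i \<le> b}"

definition hamiltonian ::
  "real ^ 'n::finite \<Rightarrow> real ^ 'n \<Rightarrow> real \<Rightarrow> real \<Rightarrow> real ^ 'n \<Rightarrow> real" where
  "hamiltonian lam mu c b p =
     (INF (lb, mb)\<in>M b. SUP u\<in>U.
        c + (\<Sum>i\<in>UNIV. p $ i * (lb $ i - u $ i * mb $ i)
                      + lam $ i * lfun (lb $ i / lam $ i)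
                      + u $ i * mu $ i * lfun (mb $ i / mu $ i)))"

definition G :: "real ^ 'n::finite \<Rightarrow> (real ^ 'n) set" where
  "G z = {x. \<forall>i. 0 \<le> x $ i \<and> x $ i < z $ i}"

definition boundary_o :: "real ^ 'n::finite \<Rightarrow> (real ^ 'n) set" where
  "boundary_o z = frontier (G z) - G z"

definition active :: "real ^ 'n::finite \<Rightarrow> 'n set" where
  "active x = {i. x $ i = 0}"

definition gam :: "'n::finite \<Rightarrow> real ^ 'n" where
  "gam i = axis i 1"

text \<open>\<open>C1_on S f Df\<close>: \<open>f\<close> is continuously differentiable on \<open>S\<close> with gradient \<open>Df\<close>, with
  derivatives taken relative to \<open>S\<close>. It is used for closed boxes with nonempty interior, where
  the gradient is unique, one-sided at the faces.\<close>

definition C1_on ::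
  "(real ^ 'n::finite) set \<Rightarrow> (real ^ 'n \<Rightarrow> real) \<Rightarrow> (real ^ 'n \<Rightarrow> real ^ 'n) \<Rightarrow> bool" where
  "C1_on S f Df \<longleftrightarrow>
     (\<forall>x\<in>S. (f has_derivative (\<lambda>h. Df x \<bullet> h)) (at x within S)) \<and> continuous_on S Df"

definition local_max_on :: "(real ^ 'n::finite) set \<Rightarrow> (real ^ 'n \<Rightarrow> real) \<Rightarrow> real ^ 'n \<Rightarrow> bool" where
  "local_max_on S f y \<longleftrightarrow> y \<in> S \<and> (\<exists>e>0. \<forall>x\<in>S \<inter> ball y e. f x \<le> f y)"

definition local_min_on :: "(real ^ 'n::finite) set \<Rightarrow> (real ^ 'n \<Rightarrow> real) \<Rightarrow> real ^ 'n \<Rightarrow> bool" where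
  "local_min_on S f y \<longleftrightarrow> y \<in> S \<and> (\<exists>e>0. \<forall>x\<in>S \<inter> ball y e. f y \<le> f x)"

text \<open>\<open>V\<close> stands for the function on \<open>G z\<close> together with its continuous extension to the closure;
  its values elsewhere are irrelevant. The extrema over the active indices are taken in the
  extended reals, so that over the empty set they are \<open>-\<infinity>\<close> and \<open>\<infinity>\<close> respectively.\<close>

definition viscosity_solution ::
  "real ^ 'n::finite \<Rightarrow> real ^ 'n \<Rightarrow> real \<Rightarrow> real \<Rightarrow> real ^ 'n \<Rightarrow> (real ^ 'n \<Rightarrow> real) \<Rightarrow> bool" where
  "viscosity_solution lam mu c b z V \<longleftrightarrow>
     (\<exists>L. L-lipschitz_on (G z) V) \<and>
     continuous_on (closure (G z)) V \<and>
     (\<forall>x\<in>boundary_o z. V x = 0) \<and>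
     (\<forall>\<theta> D\<theta>. C1_on (closure (G z)) \<theta> D\<theta> \<longrightarrow>
        (\<forall>y\<in>G z.
           (local_max_on (G z) (\<lambda>x. V x - \<theta> x) y \<longrightarrow>
              max (ereal (hamiltonian lam mu c b (D\<theta> y)))
                  (SUP i\<in>active y. ereal (D\<theta> y \<bullet> gam i)) \<ge> 0) \<and>
           (local_min_on (G z) (\<lambda>x. V x - \<theta> x) y \<longrightarrow>
              min (ereal (hamiltonian lam mu c b (D\<theta> y)))
                  (INF i\<in>active y. ereal (D\<theta> y \<bullet> gam i)) \<le> 0)))"

end

theory Submission
  imports Defs
begin

text \<open>For large \<open>b\<close> the Hamiltonian is
  \<open>H p = c + \<Sum>\<^sub>i \<lambda>\<^sub>i (1 - exp (- p\<^sub>i)) + max 0 (max\<^sub>i \<mu>\<^sub>i (1 - exp p\<^sub>i))\<close>, and \<open>\<alpha>\<^sub>i\<close> is the positive root of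
  \<open>H (- \<alpha>\<^sub>i e\<^sub>i) = 0\<close>. The gradients of the test functions touching \<open>V\<close> from above have the form
  \<open>- \<Sum>\<^sub>i w\<^sub>i \<alpha>\<^sub>i e\<^sub>i\<close> with \<open>w \<ge> 0\<close>, \<open>\<Sum>\<^sub>i w\<^sub>i \<le> 1\<close>, unless a boundary inequality holds already, and for large
  \<open>c\<close> the Hamiltonian is nonnegative there. A touching from below happens only at interior points where
  one linear piece is active, so the gradient is \<open>- \<alpha>\<^sub>i e\<^sub>i\<close>.

  Uniqueness needs no doubling of variables, because \<open>V\<close> is explicit: each linear piece, slightly
  steepened, is a smooth strict supersolution, and a smoothed, slightly flattened version of \<open>V\<close> is a
  smooth strict subsolution; both can be used directly as test functions for another solution.\<close>

section \<open>Bounds on the Hamiltonian\<close>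

text \<open>The right-hand side is convex in \<open>x\<close> with minimizer
  \<open>a * exp (- p)\<close>, so this is a Legendre transform. The proof is
  \<open>ln t <= t - 1\<close> at \<open>t = exp (- p) / y\<close>, multiplied by
  \<open>y\<close>.\<close>

lemma lfun_legendre:
  fixes a x p :: real
  assumes "a > 0" "x \<ge> 0"
  shows "a * (1 - exp (- p)) \<le> p * x + a * lfun (x / a)"
proof (cases "x = 0")
  case True
  then show ?thesis using assms by (simp add: lfun_def)
next
  case False
  define y where "y = x / a"
  have y: "y > 0" "x = a * y" using assms False by (auto simp: y_def)
  have "ln (exp (- p) / y) \<le> exp (- p) / y - 1"
    using y by (intro ln_le_minus_one) auto
  then have "- p - ln y \<le> exp (- p) / y - 1"
    using y by (simp add: ln_div)
  then have "y * (- p - ln y) \<le> y * (exp (- p) / y - 1)"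
    using y by (intro mult_left_mono) auto
  then have "1 - exp (- p) \<le> p * y + lfun y"
    using y by (simp add: lfun_def algebra_simps)
  then have "a * (1 - exp (- p)) \<le> a * (p * y + lfun y)"
    using assms by (intro mult_left_mono) auto
  then show ?thesis using y by (simp add: algebra_simps)
qed

lemma lfun_legendre_eq:
  fixes a p :: real
  assumes "a > 0"
  shows "p * (a * exp (- p)) + a * lfun (a * exp (- p) / a) = a * (1 - exp (- p))"
  using assms by (simp add: lfun_def algebra_simps)

lemma U_bounds: "u \<in> U \<Longrightarrow> 0 \<le> u $ i \<and> u $ i \<le> 1"
  using member_le_sum[of i UNIV "\<lambda>i. u $ i"] by (force simp: U_def)

lemma axis_in_U: "axis k 1 \<in> U"
  by (auto simp: U_def axis_def)

definition payoff ::
  "real ^ 'n::finite \<Rightarrow> real ^ 'n \<Rightarrow> real \<Rightarrow> real ^ 'n \<Rightarrow> (real ^ 'n) \<times> (real ^ 'n) \<Rightarrow> real ^ 'n \<Rightarrow> real"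
  where "payoff lam mu c p m u =
    c + (\<Sum>i\<in>UNIV. p $ i * (fst m $ i - u $ i * snd m $ i)
                      + lam $ i * lfun (fst m $ i / lam $ i)
                      + u $ i * mu $ i * lfun (snd m $ i / mu $ i))"

lemma hamiltonian_payoff:
  "hamiltonian lam mu c b p = (INF m\<in>M b. SUP u\<in>U. payoff lam mu c p m u)"
  unfolding hamiltonian_def payoff_def by (simp add: case_prod_unfold)

text \<open>For fixed \<open>m\<close> the payoff is affine in \<open>u\<close>, and the arrival
  rates enter only the part free of \<open>u\<close>; both bounds on the Hamiltonian rest on
  this.\<close>

lemma payoff_split:
  "payoff lam mu c p m u =
     c + (\<Sum>i\<in>UNIV. p $ i * fst m $ i + lam $ i * lfun (fst m $ i / lam $ i))
       + (\<Sum>i\<in>UNIV. u $ i * (mu $ i * lfun (snd m $ i / mu $ i) - p $ i * snd m $ i))"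
  unfolding payoff_def add.assoc sum.distrib[symmetric]
  by (auto intro!: sum.cong simp: algebra_simps)

text \<open>A real supremum is informative only over a bounded set; \<open>cSUP_upper\<close> needs
  this.\<close>

lemma payoff_bdd_above: "bdd_above (payoff lam mu c p m ` U)"
proof -
  let ?g = "\<lambda>i. mu $ i * lfun (snd m $ i / mu $ i) - p $ i * snd m $ i"
  have "u $ i * ?g i \<le> \<bar>?g i\<bar>" if "u \<in> U" for u i
    using U_bounds[OF that, of i] mult_mono[of "u $ i" 1 "?g i" "\<bar>?g i\<bar>"]
    by (smt (verit) mult_left_le_one_le mult_left_mono abs_ge_self abs_ge_zero)
  then show ?thesis
    unfolding payoff_split
    by (intro bdd_aboveI2[where M = "c + (\<Sum>i\<in>UNIV. p $ i * fst m $ i + lam $ i * lfun (fst m $ i / lam $ i))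
      + (\<Sum>i\<in>UNIV. \<bar>?g i\<bar>)"] add_left_mono sum_mono) auto
qed

text \<open>The supremum is tested at the vertex \<open>axis k 1\<close> of \<open>U\<close>; each
  rate is then bounded by its Legendre transform, uniformly in \<open>m\<close>.\<close>

lemma sup_payoff_ge:
  fixes lam mu :: "real ^ 'n::finite"
  assumes "\<And>i. lam $ i > 0" "\<And>i. mu $ i > 0" and "m \<in> M b"
  shows "c + (\<Sum>i\<in>UNIV. lam $ i * (1 - exp (- p $ i))) + mu $ k * (1 - exp (p $ k))
    \<le> (SUP u\<in>U. payoff lam mu c p m u)"
proof -
  have m: "0 \<le> fst m $ i" "0 \<le> snd m $ i" for i
    using assms(3) by (auto simp: M_def)
  have "mu $ k * (1 - exp (p $ k)) \<le> mu $ k * lfun (snd m $ k / mu $ k) - p $ k * snd m $ k"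
    using lfun_legendre[OF assms(2) m(2), where p = "- p $ k"] by simp
  also have "\<dots> = (\<Sum>i\<in>UNIV. axis k 1 $ i * (mu $ i * lfun (snd m $ i / mu $ i) - p $ i * snd m $ i))"
    by (simp add: axis_def if_distrib[of "\<lambda>x. x * _"] cong: if_cong)
  finally have "c + (\<Sum>i\<in>UNIV. lam $ i * (1 - exp (- p $ i))) + mu $ k * (1 - exp (p $ k))
      \<le> payoff lam mu c p m (axis k 1)"
    unfolding payoff_split using lfun_legendre[OF assms(1) m(1)]
    by (intro add_mono sum_mono) auto
  then show ?thesis
    using cSUP_upper[OF axis_in_U payoff_bdd_above] order_trans by blast
qed

lemma hamiltonian_ge:
  fixes lam mu :: "real ^ 'n::finite"
  assumes "\<And>i. lam $ i > 0" "\<And>i. mu $ i > 0" and "b \<ge> 0"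
  shows "c + (\<Sum>i\<in>UNIV. lam $ i * (1 - exp (- p $ i))) + mu $ k * (1 - exp (p $ k))
    \<le> hamiltonian lam mu c b p"
proof -
  \<comment> \<open>Witnesses that \<open>M b\<close> is nonempty, as \<open>cINF_greatest\<close>
    requires.\<close>
  have "(0, 0) \<in> M b" using assms(3) by (simp add: M_def)
  then show ?thesis
    unfolding hamiltonian_payoff
    by (intro cINF_greatest sup_payoff_ge[OF assms(1,2)]) auto
qed

text \<open>The Legendre minimizers do not depend on \<open>u\<close>, so one \<open>m\<close> is
  optimal against every \<open>u\<close> and no minimax theorem is involved. The hypotheses on
  \<open>b\<close> place this \<open>m\<close> in the cube.\<close>

lemma hamiltonian_le:
  fixes lam mu :: "real ^ 'n::finite"
  assumes pos: "\<And>i. lam $ i > 0" "\<And>i. mu $ i > 0"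
    and b: "\<And>i. lam $ i * exp (- p $ i) \<le> b" "\<And>i. mu $ i * exp (p $ i) \<le> b"
    and r: "\<And>u. u \<in> U \<Longrightarrow> c + (\<Sum>i\<in>UNIV. lam $ i * (1 - exp (- p $ i)))
              + (\<Sum>i\<in>UNIV. u $ i * (mu $ i * (1 - exp (p $ i)))) \<le> r"
  shows "hamiltonian lam mu c b p \<le> r"
proof -
  define m :: "(real ^ 'n) \<times> (real ^ 'n)"
    where "m = (\<chi> i. lam $ i * exp (- p $ i), \<chi> i. mu $ i * exp (p $ i))"
  have m: "m \<in> M b"
    using pos b by (auto simp: M_def m_def less_imp_le)
  have "payoff lam mu c p m u \<le> r" if "u \<in> U" for u
  proof -
    have "mu $ i * lfun (mu $ i * exp (p $ i) / mu $ i) - p $ i * (mu $ i * exp (p $ i))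
        = mu $ i * (1 - exp (p $ i))" for i
      using lfun_legendre_eq[OF pos(2), of "- p $ i" i] by simp
    then show ?thesis
      using r[OF that] lfun_legendre_eq[OF pos(1)] unfolding payoff_split by (simp add: m_def)
  qed
  moreover have "U \<noteq> ({} :: (real ^ 'n) set)" using axis_in_U by blast
  ultimately have "(SUP u\<in>U. payoff lam mu c p m u) \<le> r"
    by (intro cSUP_least) auto
  moreover have "bdd_below ((\<lambda>m. SUP u\<in>U. payoff lam mu c p m u) ` M b)"
    using sup_payoff_ge[OF pos] by (intro bdd_belowI2) auto
  ultimately show ?thesis
    unfolding hamiltonian_payoff using cINF_lower[OF _ m] order_trans by blast
qed

section \<open>The decay rates\<close>

text \<open>The equation says that the Hamiltonian vanishes at \<open>- a\<close> times a unit vector.\<close>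

lemma decay_rate_exists:
  fixes l m c :: real
  assumes "l > 0" "m > 0" "c > 0"
  shows "\<exists>a>0. l * (exp a - 1) = c + m * (1 - exp (- a))"
proof -
  define f where "f a = l * (exp a - 1) - m * (1 - exp (- a))" for a
  \<comment> \<open>At this \<open>t\<close> the arrival term equals \<open>c + m\<close>, and the
    service term takes away at most \<open>m\<close>, so \<open>f t >= c\<close>.\<close>
  define t where "t = ln (1 + (c + m) / l)"
  have pos: "0 < (c + m) / l" using assms by simp
  then have t: "t \<ge> 0" "exp t = 1 + (c + m) / l" by (simp_all add: t_def)
  have "c \<le> f t"
    using assms by (simp add: f_def t(2))
  moreover have "f 0 \<le> c" using assms by (simp add: f_def)
  moreover have "continuous_on {0..t} f" unfolding f_def by (intro continuous_intros)
  ultimately have "\<exists>a\<ge>0. a \<le> t \<and> f a = c"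
    using t(1) IVT'[of f 0 c t] by simp
  then obtain a where a: "a \<ge> 0" "f a = c" by blast
  then have "a \<noteq> 0" using assms by (auto simp: f_def)
  then show ?thesis using a by (intro exI[of _ a]) (auto simp: f_def algebra_simps)
qed

lemma exp_mult_le:
  fixes w x :: real
  assumes "0 \<le> w" "w \<le> 1"
  shows "exp (w * x) - 1 \<le> w * (exp x - 1)"
  using convex_onD[OF exp_convex, of w 0 x] assms by (simp add: algebra_simps)

text \<open>The threshold in \<open>c_ge\<close> secures \<open>c - sum_mu >= 1\<close> and
  \<open>c + mu $ i + lam $ i <= 2 * (c - sum_mu)\<close>, the two ways in which the size of
  \<open>c\<close> enters the estimates below.\<close>

locale server =
  fixes lam mu z :: "real ^ 'n::finite" and c :: real and al :: "real ^ 'n"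
  assumes lam: "\<And>i. lam $ i > 0" and mu: "\<And>i. mu $ i > 0" and z: "\<And>i. z $ i > 0"
    and al: "\<And>i. al $ i > 0"
    and rate: "\<And>i. lam $ i * (exp (al $ i) - 1) = c + mu $ i * (1 - exp (- al $ i))"
    and c_ge: "c \<ge> 1 + (\<Sum>i\<in>UNIV. lam $ i) + 3 * (\<Sum>i\<in>UNIV. mu $ i)"
begin

abbreviation "sum_mu \<equiv> \<Sum>i\<in>UNIV. mu $ i"

lemma mu_le: "mu $ i \<le> sum_mu" and lam_le: "lam $ i \<le> (\<Sum>i\<in>UNIV. lam $ i)"
  using mu lam by (auto intro!: member_le_sum simp: less_imp_le)

lemma sum_mu_nonneg: "0 \<le> sum_mu"
  using mu by (intro sum_nonneg) (simp add: less_imp_le)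

lemma rate_ge: "c \<le> lam $ i * (exp (al $ i) - 1)"
  using mu[of i] al[of i] rate[of i] by simp

text \<open>The dominant weight, at \<open>k\<close>, leaves all others at most \<open>1/2\<close>, so their contribution is of
  order \<open>exp (al / 2)\<close>, about the square root of \<open>c\<close>; lowering the weight at \<open>k\<close> from 1 gains an amount
  proportional to \<open>c\<close>. This is where \<open>c\<close> has to be large.\<close>

lemma hamiltonian_mixture_ge:
  assumes b: "b \<ge> 0" and w: "\<And>i. 0 \<le> w i" "(\<Sum>i\<in>UNIV. w i) \<le> 1 - e" and "0 \<le> e" "0 \<le> d"
  shows "e - sum_mu * (exp d - 1) \<le> hamiltonian lam mu c b (\<chi> i. d - w i * al $ i)"
proof -
  obtain k where k: "\<And>i. w i \<le> w k"
  proof -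
    have "Max (range w) \<in> range w" by (intro Max_in) auto
    then obtain k where "Max (range w) = w k" by blast
    moreover have "w i \<le> Max (range w)" for i by (intro Max_ge) auto
    ultimately show ?thesis using that by metis
  qed
  \<comment> \<open>Each weight off \<open>k\<close> costs at most \<open>B\<close> per unit, while
    lowering the weight at \<open>k\<close> gains \<open>c\<close> per unit, and
    \<open>c >= B\<close>.\<close>
  define B where "B = c - sum_mu"
  have B: "1 \<le> B"
    using c_ge sum_mu_nonneg sum_nonneg[of UNIV "\<lambda>i. lam $ i"] lam
    by (simp add: B_def less_imp_le)
  have sum_split: "(\<Sum>i\<in>UNIV. f i) = f k + (\<Sum>i\<in>UNIV - {k}. f i)" for f :: "'n \<Rightarrow> real"
    by (rule sum.remove) auto
  have wk1: "w k \<le> 1"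
    using w assms(4) sum_nonneg[of "UNIV - {k}" w] unfolding sum_split by simp
  have off: "lam $ i * (exp (w i * al $ i) - 1) \<le> B * w i" if "i \<noteq> k" for i
  proof -
    have "w i + w k = (\<Sum>j\<in>{i, k}. w j)" using that by simp
    also have "\<dots> \<le> (\<Sum>j\<in>UNIV. w j)" by (rule sum_mono2) (auto simp: w)
    finally have "2 * w i \<le> 1" using k[of i] w(2) assms(4) by simp
    then have "exp (2 * w i * (al $ i / 2)) - 1 \<le> 2 * w i * (exp (al $ i / 2) - 1)"
      using w(1)[of i] by (intro exp_mult_le) auto
    then have "lam $ i * (exp (w i * al $ i) - 1) \<le> lam $ i * (2 * w i * (exp (al $ i / 2) - 1))"
      using lam[of i] by (intro mult_left_mono) auto
    also have "\<dots> = w i * (2 * lam $ i * (exp (al $ i / 2) - 1))" by simp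
    also have "\<dots> \<le> w i * B"
    proof (intro mult_left_mono w)
      \<comment> \<open>Completing the square trades \<open>exp (al $ i / 2)\<close> for
        \<open>exp (al $ i)\<close>, which \<open>rate\<close> bounds in terms of
        \<open>c\<close>.\<close>
      have "0 \<le> (exp (al $ i / 2) - 2)\<^sup>2" by simp
      also have "\<dots> = exp (al $ i) - 4 * exp (al $ i / 2) + 4"
        by (simp add: power2_eq_square algebra_simps flip: exp_add)
      finally have "lam $ i * (4 * exp (al $ i / 2)) \<le> lam $ i * (exp (al $ i) + 4)"
        using lam[of i] by (intro mult_left_mono) auto
      then have "4 * lam $ i * (exp (al $ i / 2) - 1) \<le> lam $ i * (exp (al $ i) - 1) + lam $ i"
        by (simp add: algebra_simps)
      also have "\<dots> \<le> c + mu $ i + lam $ i"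
        using rate[of i] mult_pos_pos[OF mu[of i] exp_gt_zero[of "- al $ i"]] by (simp add: algebra_simps)
      also have "\<dots> \<le> 2 * B"
        using c_ge mu_le[of i] lam_le[of i] by (simp add: B_def)
      finally show "2 * lam $ i * (exp (al $ i / 2) - 1) \<le> B" by simp
    qed
    finally show ?thesis by (simp add: mult.commute)
  qed
  \<comment> \<open>As a function of \<open>w k\<close>, the arrival cost minus the service gain at
    \<open>k\<close> is convex, vanishes at 0 and equals \<open>c\<close> at 1 by
    \<open>rate\<close>; hence it is at most \<open>w k * c\<close>.\<close>
  have "lam $ k * (exp (w k * al $ k) - 1) \<le> w k * (lam $ k * (exp (al $ k) - 1))"
    using mult_left_mono[OF exp_mult_le[OF w(1) wk1, of "al $ k"], of "lam $ k"] lam[of k]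
    by (simp add: algebra_simps)
  moreover have "(1 - w k) * (c + mu $ k * (1 - exp (- al $ k)))
      = (1 - w k) * (lam $ k * (exp (al $ k) - 1))"
    using rate by simp
  moreover have "mu $ k * (exp (- (w k * al $ k)) - 1) \<le> w k * (mu $ k * (exp (- al $ k) - 1))"
    using mult_left_mono[OF exp_mult_le[OF w(1) wk1, of "- al $ k"], of "mu $ k"] mu[of k]
    by (simp add: algebra_simps)
  ultimately have main: "(1 - w k) * c
      \<le> c - lam $ k * (exp (w k * al $ k) - 1) + mu $ k * (1 - exp (- (w k * al $ k)))"
    using rate[of k] by (simp add: algebra_simps)
  have others: "(\<Sum>i\<in>UNIV - {k}. lam $ i * (exp (w i * al $ i) - 1)) \<le> B * (1 - e - w k)"
  proof -
    have "(\<Sum>i\<in>UNIV - {k}. lam $ i * (exp (w i * al $ i) - 1)) \<le> (\<Sum>i\<in>UNIV - {k}. B * w i)"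
      using off by (intro sum_mono) auto
    also have "\<dots> = B * (\<Sum>i\<in>UNIV - {k}. w i)" by (simp add: sum_distrib_left)
    also have "\<dots> \<le> B * (1 - e - w k)"
      using w(2) B unfolding sum_split by (intro mult_left_mono) auto
    finally show ?thesis .
  qed
  let ?p = "\<chi> i. d - w i * al $ i"
  \<comment> \<open>Raising every coordinate by \<open>d\<close> only helps the arrival terms; the
    service term at \<open>k\<close> drops by at most \<open>sum_mu * (exp d - 1)\<close>.\<close>
  have shift: "mu $ k * (1 - exp (- (w k * al $ k))) - sum_mu * (exp d - 1) \<le> mu $ k * (1 - exp (?p $ k))"
  proof -
    have "exp (?p $ k) - exp (- (w k * al $ k)) = exp (- (w k * al $ k)) * (exp d - 1)"
      by (simp add: algebra_simps flip: exp_add)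
    also have "\<dots> \<le> 1 * (exp d - 1)"
      using w(1)[of k] al[of k] assms by (intro mult_right_mono) (auto simp: less_imp_le)
    finally have "mu $ k * (exp (?p $ k) - exp (- (w k * al $ k))) \<le> mu $ k * (exp d - 1)"
      using mu[of k] by (intro mult_left_mono) auto
    also have "\<dots> \<le> sum_mu * (exp d - 1)"
      using mu_le[of k] assms by (intro mult_right_mono) auto
    finally show ?thesis by (simp add: algebra_simps)
  qed
  have "e \<le> B * e" using B assms by (simp add: mult_le_cancel_right1)
  \<comment> \<open>The two sides differ by \<open>(1 - w k) * sum_mu\<close>.\<close>
  also have "\<dots> \<le> (1 - w k) * c - B * (1 - e - w k)"
    using mult_nonneg_nonneg[of "1 - w k" sum_mu] wk1 sum_mu_nonneg
    by (simp add: B_def algebra_simps)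
  also have "\<dots> \<le> c + (\<Sum>i\<in>UNIV. lam $ i * (1 - exp (w i * al $ i))) + mu $ k * (1 - exp (- (w k * al $ k)))"
  proof -
    have "(\<Sum>i\<in>UNIV - {k}. lam $ i * (1 - exp (w i * al $ i)))
        = - (\<Sum>i\<in>UNIV - {k}. lam $ i * (exp (w i * al $ i) - 1))"
      by (simp add: sum_negf[symmetric] algebra_simps)
    then show ?thesis unfolding sum_split using main others by (simp add: algebra_simps)
  qed
  also have "\<dots> - sum_mu * (exp d - 1)
      \<le> c + (\<Sum>i\<in>UNIV. lam $ i * (1 - exp (- ?p $ i))) + mu $ k * (1 - exp (?p $ k))"
  proof -
    have "(\<Sum>i\<in>UNIV. lam $ i * (1 - exp (w i * al $ i))) \<le> (\<Sum>i\<in>UNIV. lam $ i * (1 - exp (- ?p $ i)))"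
      using lam assms(5) by (intro sum_mono mult_left_mono) (auto simp: less_imp_le)
    then show ?thesis using shift by simp
  qed
  also have "\<dots> \<le> hamiltonian lam mu c b ?p" by (rule hamiltonian_ge[OF lam mu b])
  finally show ?thesis by simp
qed

text \<open>Dominates the optimal rates at every gradient in \<open>hamiltonian_axis_le\<close>; the
  \<open>+ 1\<close> in the exponent leaves room for the shift \<open>e <= 1\<close>.\<close>

definition "rate_bound = (\<Sum>i\<in>UNIV. lam $ i * exp (al $ i + 1)) + sum_mu"

lemma rate_bound_nonneg: "0 \<le> rate_bound"
  unfolding rate_bound_def using lam mu by (intro add_nonneg_nonneg sum_nonneg) (auto simp: less_imp_le)

text \<open>For \<open>e = 0\<close> the bound comes from \<open>rate\<close>. Lowering all
  coordinates by \<open>e\<close> lowers the arrival term at \<open>i\<close> by at least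
  \<open>lam $ i * exp (al $ i) * e >= c * e\<close>, raises the service terms by at most
  \<open>sum_mu * e\<close>, and \<open>c >= 1 + sum_mu\<close>. The other arrival terms are
  nonpositive.\<close>

lemma hamiltonian_axis_le:
  assumes b: "rate_bound \<le> b" and e: "0 \<le> e" "e \<le> 1"
  shows "hamiltonian lam mu c b (\<chi> j. - (if j = i then al $ i else 0) - e) \<le> - e"
proof (rule hamiltonian_le[OF lam mu])
  let ?p = "(\<chi> j. - (if j = i then al $ i else 0) - e) :: real ^ 'n"
  show "lam $ j * exp (- ?p $ j) \<le> b" for j
  proof -
    have "lam $ j * exp (- ?p $ j) \<le> lam $ j * exp (al $ j + 1)"
      using lam[of j] al[of j] e by (intro mult_left_mono) (auto simp: less_imp_le)
    also have "\<dots> \<le> (\<Sum>i\<in>UNIV. lam $ i * exp (al $ i + 1))"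
      using lam by (intro member_le_sum) (auto simp: less_imp_le)
    finally show ?thesis using b sum_mu_nonneg by (simp add: rate_bound_def)
  qed
  show "mu $ j * exp (?p $ j) \<le> b" for j
  proof -
    have "mu $ j * exp (?p $ j) \<le> mu $ j * 1"
      using mu[of j] al[of i] e by (intro mult_left_mono) (auto simp: less_imp_le)
    moreover have "0 \<le> (\<Sum>i\<in>UNIV. lam $ i * exp (al $ i + 1))"
      using lam by (intro sum_nonneg) (auto simp: less_imp_le)
    ultimately show ?thesis using b mu_le[of j] unfolding rate_bound_def by simp
  qed
  fix u :: "real ^ 'n" assume u: "u \<in> U"
  have "(\<Sum>j\<in>UNIV. lam $ j * (1 - exp (- ?p $ j)))
      \<le> (\<Sum>j\<in>UNIV. if j = i then lam $ i * (1 - exp (al $ i + e)) else 0)"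
    using lam e by (intro sum_mono) (auto simp: mult_le_0_iff less_imp_le add.commute)
  then have 1: "(\<Sum>j\<in>UNIV. lam $ j * (1 - exp (- ?p $ j))) \<le> lam $ i * (1 - exp (al $ i + e))"
    by simp
  have "u $ j * (mu $ j * (1 - exp (?p $ j)))
      \<le> (if j = i then mu $ i * (1 - exp (- al $ i)) else 0) + e * mu $ j" for j
  proof -
    have "1 - exp (- e) \<le> e" using exp_ge_add_one_self[of "- e"] by simp
    moreover have "exp (- al $ i) * (1 - exp (- e)) \<le> 1 * e"
      using al[of i] e calculation by (intro mult_mono) (auto simp: less_imp_le)
    then have "1 - exp (- al $ i - e) \<le> 1 - exp (- al $ i) + e"
      using exp_add[of "- al $ i" "- e"] by (simp add: right_diff_distrib)
    ultimately have "1 - exp (?p $ j) \<le> (if j = i then 1 - exp (- al $ i) else 0) + e"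
      by simp
    then have "mu $ j * (1 - exp (?p $ j)) \<le> mu $ j * ((if j = i then 1 - exp (- al $ i) else 0) + e)"
      using mu[of j] by (intro mult_left_mono) auto
    moreover have "0 \<le> mu $ j * (1 - exp (?p $ j))"
      using mu[of j] al[of i] e by (auto simp: less_imp_le)
    then have "u $ j * (mu $ j * (1 - exp (?p $ j))) \<le> mu $ j * (1 - exp (?p $ j))"
      using U_bounds[OF u, of j] by (simp add: mult_left_le_one_le)
    ultimately show ?thesis by (auto simp: algebra_simps)
  qed
  then have "(\<Sum>j\<in>UNIV. u $ j * (mu $ j * (1 - exp (?p $ j))))
      \<le> (\<Sum>j\<in>UNIV. (if j = i then mu $ i * (1 - exp (- al $ i)) else 0) + e * mu $ j)"
    by (intro sum_mono)
  also have "\<dots> = mu $ i * (1 - exp (- al $ i)) + e * sum_mu"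
    by (simp add: sum.distrib sum_distrib_left)
  finally have 2: "(\<Sum>j\<in>UNIV. u $ j * (mu $ j * (1 - exp (?p $ j))))
      \<le> mu $ i * (1 - exp (- al $ i)) + e * sum_mu" .
  have "lam $ i * exp (al $ i) * (1 + e) \<le> lam $ i * exp (al $ i) * exp e"
    using lam[of i] by (intro mult_left_mono exp_ge_add_one_self) auto
  moreover have "c * e \<le> lam $ i * exp (al $ i) * e"
    using rate_ge[of i] lam[of i] e by (intro mult_right_mono) (auto simp: algebra_simps)
  moreover have "(1 + sum_mu) * e \<le> c * e"
    using c_ge sum_mu_nonneg lam_le[of i] lam[of i] e by (intro mult_right_mono) auto
  ultimately show "c + (\<Sum>j\<in>UNIV. lam $ j * (1 - exp (- ?p $ j)))
      + (\<Sum>j\<in>UNIV. u $ j * (mu $ j * (1 - exp (?p $ j)))) \<le> - e"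
    using 1 2 rate[of i] by (simp add: exp_add algebra_simps)
qed

section \<open>Test functions along segments\<close>

definition "V x = (MIN i\<in>UNIV. al $ i * (z $ i - x $ i))"

lemma V_le: "V x \<le> al $ i * (z $ i - x $ i)"
  unfolding V_def by (intro Min_le) auto

lemma V_ge: "(\<And>i. r \<le> al $ i * (z $ i - x $ i)) \<Longrightarrow> r \<le> V x"
  unfolding V_def by (intro Min.boundedI) auto

lemma V_attained: "\<exists>i. V x = al $ i * (z $ i - x $ i)"
proof -
  have "V x \<in> range (\<lambda>i. al $ i * (z $ i - x $ i))" unfolding V_def by (intro Min_in) auto
  then show ?thesis by blast
qed

lemma closure_G_nonempty: "closure (G z) \<noteq> {}"
proof -
  have "0 \<in> G z" using z by (simp add: G_def)
  then show ?thesis by auto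
qed

lemma closure_G: "x \<in> closure (G z) \<Longrightarrow> 0 \<le> x $ i \<and> x $ i \<le> z $ i"
proof -
  have "G z \<subseteq> cbox 0 z" by (auto simp: G_def mem_box_cart less_imp_le)
  then have "closure (G z) \<subseteq> cbox 0 z" by (rule closure_minimal) (rule closed_cbox)
  then show "x \<in> closure (G z) \<Longrightarrow> 0 \<le> x $ i \<and> x $ i \<le> z $ i"
    by (auto simp: mem_box_cart)
qed

lemma compact_closure_G: "compact (closure (G z))"
proof -
  have "G z \<subseteq> cbox 0 z" by (auto simp: G_def mem_box_cart less_imp_le)
  then show ?thesis using bounded_cbox bounded_subset compact_closure by blast
qed

lemma closure_G_cases:
  assumes "x \<in> closure (G z)"
  shows "x \<in> G z \<or> x \<in> boundary_o z"
  using assms interior_subset by (auto simp: boundary_o_def frontier_def)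

lemma boundary_o_face:
  assumes "x \<in> boundary_o z"
  shows "x \<in> closure (G z)" "\<exists>i. x $ i = z $ i"
proof -
  show x: "x \<in> closure (G z)" using assms by (auto simp: boundary_o_def frontier_def)
  have "x \<notin> G z" using assms by (auto simp: boundary_o_def)
  then show "\<exists>i. x $ i = z $ i"
    using closure_G[OF x] by (auto simp: G_def) (metis order.order_iff_strict)
qed

lemma V_lipschitz: "(\<Sum>i\<in>UNIV. al $ i)-lipschitz_on S V"
proof (rule lipschitz_onI)
  show nonneg: "0 \<le> (\<Sum>i\<in>UNIV. al $ i)" using al by (intro sum_nonneg) (simp add: less_imp_le)
  have *: "V x - V y \<le> (\<Sum>i\<in>UNIV. al $ i) * dist x y" for x y
  proof -
    \<comment> \<open>The minimizing index at the subtracted point turns a difference of minima into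
      a difference within one linear piece.\<close>
    obtain i where i: "V y = al $ i * (z $ i - y $ i)" using V_attained by blast
    have "V x - V y \<le> al $ i * (y $ i - x $ i)"
      using V_le[of x i] i by (simp add: algebra_simps)
    also have "\<dots> \<le> al $ i * dist x y"
      using al[of i] component_le_norm_cart[of "y - x" i]
      by (intro mult_left_mono) (auto simp: dist_norm norm_minus_commute)
    also have "\<dots> \<le> (\<Sum>i\<in>UNIV. al $ i) * dist x y"
      using al by (intro mult_right_mono member_le_sum) (auto simp: less_imp_le)
    finally show ?thesis .
  qed
  show "dist (V x) (V y) \<le> (\<Sum>i\<in>UNIV. al $ i) * dist x y" for x y
    using *[of x y] *[of y x] by (simp add: dist_real_def dist_commute abs_le_iff)
qed

lemma V_boundary_o:
  assumes "x \<in> boundary_o z"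
  shows "V x = 0"
proof (rule antisym)
  obtain i where "x $ i = z $ i" using boundary_o_face[OF assms] by blast
  then show "V x \<le> 0" using V_le[of x i] by simp
  show "0 \<le> V x"
    using closure_G[OF boundary_o_face(1)[OF assms]] al
    by (intro V_ge mult_nonneg_nonneg) (auto simp: less_imp_le)
qed

section \<open>One-sided derivatives and the gradients of touching test functions\<close>

lemma eventually_segment_in_G:
  assumes y: "y \<in> G z" and h: "\<And>i. i \<in> active y \<Longrightarrow> 0 \<le> h $ i"
  shows "\<forall>\<^sub>F t in at_right 0. y + t *\<^sub>R h \<in> G z"
proof -
  have "\<forall>\<^sub>F t in at_right 0. 0 \<le> y $ i + t * h $ i \<and> y $ i + t * h $ i < z $ i" for i
  proof -
    have lim: "((\<lambda>t. y $ i + t * h $ i) \<longlongrightarrow> y $ i + 0 * h $ i) (at_right 0)"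
      by (intro tendsto_intros)
    have yi: "0 \<le> y $ i" "y $ i < z $ i" using y by (auto simp: G_def)
    then have "\<forall>\<^sub>F t in at_right 0. y $ i + t * h $ i < z $ i"
      using lim by (intro order_tendstoD(2)) auto
    moreover have "\<forall>\<^sub>F t in at_right 0. 0 \<le> y $ i + t * h $ i"
    proof (cases "y $ i = 0")
      case True
      then have "0 \<le> h $ i" using h by (simp add: active_def)
      then show ?thesis
        using True by (intro eventually_mono[OF eventually_at_right_less]) simp
    next
      case False
      then have "\<forall>\<^sub>F t in at_right 0. 0 < y $ i + t * h $ i"
        using lim yi by (intro order_tendstoD(1)) auto
      then show ?thesis by (rule eventually_mono) simp
    qed
    ultimately show ?thesis by eventually_elim simp
  qed
  then have "\<forall>\<^sub>F t in at_right 0. \<forall>i. 0 \<le> y $ i + t * h $ i \<and> y $ i + t * h $ i < z $ i"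
    by (intro eventually_all_finite)
  then show ?thesis by (rule eventually_mono) (simp add: G_def)
qed

text \<open>Test functions are differentiable only relative to the set, so directional derivatives
  are one-sided, along segments that stay inside.\<close>

lemma directional_derivative:
  fixes f :: "real ^ 'n \<Rightarrow> real"
  assumes f: "(f has_derivative (\<lambda>h. p \<bullet> h)) (at y within S)"
    and S: "\<forall>\<^sub>F t in at_right 0. y + t *\<^sub>R h \<in> S"
  shows "((\<lambda>t. (f (y + t *\<^sub>R h) - f y) / t) \<longlongrightarrow> p \<bullet> h) (at_right 0)"
proof -
  define T where "T = {t. y + t *\<^sub>R h \<in> S}"
  let ?g = "\<lambda>t. y + t *\<^sub>R h"
  have "(?g has_derivative (\<lambda>t. t *\<^sub>R h)) (at 0 within T)"
    by (auto intro!: derivative_eq_intros)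
  moreover have "(f has_derivative (\<lambda>h. p \<bullet> h)) (at (?g 0) within ?g ` T)"
    using f by (auto simp: T_def intro: has_derivative_subset)
  ultimately have "((\<lambda>t. f (?g t)) has_derivative (\<lambda>t. p \<bullet> (t *\<^sub>R h))) (at 0 within T)"
    by (rule has_derivative_in_compose)
  then have "((\<lambda>t. f (?g t)) has_field_derivative (p \<bullet> h)) (at 0 within T)"
    unfolding has_field_derivative_def by (simp add: mult_commute_abs)
  then have "((\<lambda>t. (f (?g t) - f y) / t) \<longlongrightarrow> p \<bullet> h) (at 0 within T)"
    by (simp add: has_field_derivative_iff)
  \<comment> \<open>Small positive \<open>t\<close> belong to \<open>T\<close>, so a limit within
    \<open>T\<close> yields the right-hand limit.\<close>
  moreover have "at_right 0 \<le> at 0 within T"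
  proof -
    have "\<forall>\<^sub>F t in at_right 0. t \<in> T - {0}"
      using S eventually_at_right_less[of 0] by eventually_elim (auto simp: T_def)
    then have "at_right 0 \<le> principal (T - {0})" by (simp add: le_principal)
    moreover have "at_right (0::real) \<le> nhds 0" unfolding at_within_def by (rule inf_le1)
    ultimately show ?thesis unfolding at_within_def[of _ T] by (rule inf_greatest[rotated])
  qed
  ultimately show ?thesis by (rule tendsto_mono[rotated])
qed

lemma eventually_near_segment:
  assumes "0 < e" and "\<forall>x\<in>G z \<inter> ball y e. P x"
    and "\<forall>\<^sub>F t in at_right 0. y + t *\<^sub>R h \<in> G z"
  shows "\<forall>\<^sub>F t in at_right 0. P (y + t *\<^sub>R h)"
proof -
  have "((\<lambda>t. y + t *\<^sub>R h) \<longlongrightarrow> y + 0 *\<^sub>R h) (at_right 0)" by (intro tendsto_intros)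
  then have "\<forall>\<^sub>F t in at_right 0. dist (y + t *\<^sub>R h) y < e"
    using assms(1) by (auto dest: tendstoD)
  then show ?thesis
    using assms(3) by eventually_elim (use assms(2) in \<open>auto simp: dist_commute\<close>)
qed

text \<open>Touching from above, \<open>th\<close> grows along \<open>h\<close> at least as fast as
  \<open>V\<close>, and a minimum of linear pieces grows at least at rate \<open>d\<close> if every
  piece does.\<close>

lemma local_max_direction:
  assumes th: "C1_on (closure (G z)) th Dth" and lm: "local_max_on (G z) (\<lambda>x. V x - th x) y"
    and h: "\<And>i. i \<in> active y \<Longrightarrow> 0 \<le> h $ i"
    and d: "\<And>i. d \<le> - (al $ i * h $ i)"
  shows "d \<le> Dth y \<bullet> h"
proof -
  obtain e where y: "y \<in> G z" and e: "e > 0" "\<forall>x\<in>G z \<inter> ball y e. V x - th x \<le> V y - th y"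
    using lm by (auto simp: local_max_on_def)
  have seg: "\<forall>\<^sub>F t in at_right 0. y + t *\<^sub>R h \<in> G z"
    by (rule eventually_segment_in_G[OF y]) (rule h)
  have der: "(th has_derivative (\<lambda>h. Dth y \<bullet> h)) (at y within G z)"
    using th y closure_subset[of "G z"] by (auto simp: C1_on_def intro: has_derivative_subset)
  have "\<forall>\<^sub>F t in at_right 0. d \<le> (th (y + t *\<^sub>R h) - th y) / t"
    using eventually_near_segment[OF e seg] eventually_at_right_less[of 0]
  proof eventually_elim
    case (elim t)
    have "V y + t * d \<le> al $ i * (z $ i - (y + t *\<^sub>R h) $ i)" for i
    proof -
      have "t * d \<le> t * (- (al $ i * h $ i))" using elim d by (intro mult_left_mono) auto
      then show ?thesis using V_le[of y i] by (simp add: algebra_simps)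
    qed
    then have "V y + t * d \<le> V (y + t *\<^sub>R h)" by (intro V_ge)
    then show ?case using elim by (simp add: field_simps)
  qed
  then show ?thesis
    using tendsto_lowerbound[OF directional_derivative[OF der seg]] by simp
qed

text \<open>Touching from below, \<open>th\<close> grows no faster than \<open>V\<close>, which
  stays below the piece attaining the minimum at \<open>y\<close>.\<close>

lemma local_min_direction:
  assumes th: "C1_on (closure (G z)) th Dth" and lm: "local_min_on (G z) (\<lambda>x. V x - th x) y"
    and h: "\<And>i. i \<in> active y \<Longrightarrow> 0 \<le> h $ i"
    and i: "V y = al $ i * (z $ i - y $ i)"
  shows "Dth y \<bullet> h \<le> - (al $ i * h $ i)"
proof -
  obtain e where y: "y \<in> G z" and e: "e > 0" "\<forall>x\<in>G z \<inter> ball y e. V y - th y \<le> V x - th x"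
    using lm by (auto simp: local_min_on_def)
  have seg: "\<forall>\<^sub>F t in at_right 0. y + t *\<^sub>R h \<in> G z"
    by (rule eventually_segment_in_G[OF y]) (rule h)
  have der: "(th has_derivative (\<lambda>h. Dth y \<bullet> h)) (at y within G z)"
    using th y closure_subset[of "G z"] by (auto simp: C1_on_def intro: has_derivative_subset)
  have "\<forall>\<^sub>F t in at_right 0. (th (y + t *\<^sub>R h) - th y) / t \<le> - (al $ i * h $ i)"
    using eventually_near_segment[OF e seg] eventually_at_right_less[of 0]
  proof eventually_elim
    case (elim t)
    have "V (y + t *\<^sub>R h) \<le> V y - t * (al $ i * h $ i)"
      using V_le[of "y + t *\<^sub>R h" i] i by (simp add: algebra_simps)
    then have "th (y + t *\<^sub>R h) - th y \<le> - (al $ i * h $ i) * t"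
      using elim by (simp add: algebra_simps)
    then show ?case using elim by (simp add: pos_divide_le_eq)
  qed
  then show ?thesis
    using tendsto_upperbound[OF directional_derivative[OF der seg]] by simp
qed

section \<open>Existence\<close>

lemma V_subsolution:
  assumes b: "b \<ge> 0" and th: "C1_on (closure (G z)) th Dth"
    and lm: "local_max_on (G z) (\<lambda>x. V x - th x) y"
    and act: "\<And>i. i \<in> active y \<Longrightarrow> Dth y $ i < 0"
  shows "0 \<le> hamiltonian lam mu c b (Dth y)"
proof -
  note dir = local_max_direction[OF th lm]
  have nonpos: "Dth y $ i \<le> 0" for i
  proof (cases "i \<in> active y")
    case True
    then show ?thesis using act by (simp add: less_imp_le)
  next
    case False
    \<comment> \<open>Moving against an inactive coordinate is admissible, and no piece decreases
      along it.\<close>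
    then have "0 \<le> Dth y \<bullet> - axis i 1"
      using al by (intro dir) (auto simp: axis_def less_imp_le)
    then show ?thesis by (simp add: inner_axis)
  qed
  \<comment> \<open>Along this direction every piece falls at unit speed, which bounds the sum of
    the weights \<open>- Dth y $ i / al $ i\<close> by 1.\<close>
  have "-1 \<le> Dth y \<bullet> (\<chi> i. 1 / al $ i)"
    using al by (intro dir) (auto simp: less_imp_le less_imp_neq[OF al, symmetric])
  then have "(\<Sum>i\<in>UNIV. - Dth y $ i / al $ i) \<le> 1 - 0"
    by (simp add: inner_vec_def sum_negf)
  moreover have "0 \<le> - Dth y $ i / al $ i" for i
    using nonpos[of i] al[of i] by (simp add: divide_nonpos_pos)
  ultimately have "0 - sum_mu * (exp 0 - 1)
      \<le> hamiltonian lam mu c b (\<chi> i. 0 - (- Dth y $ i / al $ i) * al $ i)"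
    by (intro hamiltonian_mixture_ge[OF b]) auto
  moreover have "(\<chi> i. 0 - (- Dth y $ i / al $ i) * al $ i) = Dth y"
    by (simp add: vec_eq_iff less_imp_neq[OF al, symmetric])
  ultimately show ?thesis by simp
qed

lemma V_supersolution:
  assumes b: "b \<ge> rate_bound" and th: "C1_on (closure (G z)) th Dth"
    and lm: "local_min_on (G z) (\<lambda>x. V x - th x) y"
    and act: "\<And>i. i \<in> active y \<Longrightarrow> 0 < Dth y $ i"
  shows "hamiltonian lam mu c b (Dth y) \<le> 0"
proof -
  obtain i where i: "V y = al $ i * (z $ i - y $ i)" using V_attained by blast
  note dir = local_min_direction[OF th lm _ i]
  have up: "Dth y $ j \<le> - (if j = i then al $ i else 0)" for j
  proof -
    have "Dth y \<bullet> axis j 1 \<le> - (al $ i * axis j 1 $ i)" by (rule dir) (simp add: axis_def)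
    then show ?thesis unfolding inner_axis by (auto simp: axis_def)
  qed
  \<comment> \<open>The upper bounds make all components nonpositive, so \<open>act\<close> excludes
    active indices; the directions \<open>- axis j 1\<close> then become admissible too.\<close>
  then have inact: "j \<notin> active y" for j
    using act[of j] al[of i] by (smt (verit))
  have "- Dth y $ j \<le> (if j = i then al $ i else 0)" for j
  proof -
    have "Dth y \<bullet> - axis j 1 \<le> - (al $ i * (- axis j 1) $ i)" by (rule dir) (simp add: inact)
    then show ?thesis unfolding inner_minus_right inner_axis by (auto simp: axis_def)
  qed
  then have "Dth y = (\<chi> j. - (if j = i then al $ i else 0) - 0)"
    using up by (simp add: vec_eq_iff) (smt (verit))
  then show ?thesis using hamiltonian_axis_le[OF b, of 0 i] by simp
qed

lemma V_viscosity_solution: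
  assumes "b \<ge> rate_bound"
  shows "viscosity_solution lam mu c b z V"
  unfolding viscosity_solution_def
proof (intro conjI allI impI ballI)
  show "\<exists>L. L-lipschitz_on (G z) V" using V_lipschitz by blast
  show "continuous_on (closure (G z)) V"
    by (rule lipschitz_on_continuous_on[OF V_lipschitz])
  show "V x = 0" if "x \<in> boundary_o z" for x using V_boundary_o[OF that] .
next
  fix th Dth y
  assume th: "C1_on (closure (G z)) th Dth" and lm: "local_max_on (G z) (\<lambda>x. V x - th x) y"
  show "0 \<le> max (ereal (hamiltonian lam mu c b (Dth y))) (SUP i\<in>active y. ereal (Dth y \<bullet> gam i))"
  proof (cases "\<exists>i\<in>active y. 0 \<le> Dth y $ i")
    case True
    then obtain i where i: "i \<in> active y" "0 \<le> Dth y \<bullet> gam i"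
      by (auto simp: gam_def inner_axis)
    then have "0 \<le> (SUP i\<in>active y. ereal (Dth y \<bullet> gam i))"
      by (intro SUP_upper2[of i]) auto
    then show ?thesis by (simp add: le_max_iff_disj)
  next
    case False
    then have "0 \<le> hamiltonian lam mu c b (Dth y)"
      using assms rate_bound_nonneg by (intro V_subsolution[OF _ th lm]) (auto simp: not_le)
    then show ?thesis by (simp add: le_max_iff_disj)
  qed
next
  fix th Dth y
  assume th: "C1_on (closure (G z)) th Dth" and lm: "local_min_on (G z) (\<lambda>x. V x - th x) y"
  show "min (ereal (hamiltonian lam mu c b (Dth y))) (INF i\<in>active y. ereal (Dth y \<bullet> gam i)) \<le> 0"
  proof (cases "\<exists>i\<in>active y. Dth y $ i \<le> 0")
    case True
    then obtain i where i: "i \<in> active y" "Dth y \<bullet> gam i \<le> 0"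
      by (auto simp: gam_def inner_axis)
    then have "(INF i\<in>active y. ereal (Dth y \<bullet> gam i)) \<le> 0"
      by (intro INF_lower2[of i]) auto
    then show ?thesis by (simp add: min_le_iff_disj)
  next
    case False
    then have "hamiltonian lam mu c b (Dth y) \<le> 0"
      using assms by (intro V_supersolution[OF _ th lm]) (auto simp: not_le)
    then show ?thesis by (simp add: min_le_iff_disj)
  qed
qed

section \<open>Uniqueness\<close>

lemma viscosity_solution_local_max:
  assumes "viscosity_solution lam mu c b z W" "C1_on (closure (G z)) th Dth" "y \<in> G z"
    "local_max_on (G z) (\<lambda>x. W x - th x) y"
  shows "0 \<le> max (ereal (hamiltonian lam mu c b (Dth y))) (SUP i\<in>active y. ereal (Dth y \<bullet> gam i))"
  using assms(1)[unfolded viscosity_solution_def, THEN conjunct2, THEN conjunct2, THEN conjunct2,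
      THEN spec, THEN spec, THEN mp, THEN bspec, THEN conjunct1, THEN mp, OF assms(2-4)] .

lemma viscosity_solution_local_min:
  assumes "viscosity_solution lam mu c b z W" "C1_on (closure (G z)) th Dth" "y \<in> G z"
    "local_min_on (G z) (\<lambda>x. W x - th x) y"
  shows "min (ereal (hamiltonian lam mu c b (Dth y))) (INF i\<in>active y. ereal (Dth y \<bullet> gam i)) \<le> 0"
  using assms(1)[unfolded viscosity_solution_def, THEN conjunct2, THEN conjunct2, THEN conjunct2,
      THEN spec, THEN spec, THEN mp, THEN bspec, THEN conjunct2, THEN mp, OF assms(2-4)] .

text \<open>\<open>th\<close> itself is the test function: a maximum point of \<open>W - th\<close>
  over the compact closure cannot lie in \<open>G z\<close>, where strictness contradicts the
  subsolution property of \<open>W\<close>, so it lies where \<open>W = 0 <= th\<close>.\<close>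

lemma comparison_above:
  assumes W: "viscosity_solution lam mu c b z W"
    and th: "C1_on (closure (G z)) th Dth"
    and bd: "\<And>x. x \<in> boundary_o z \<Longrightarrow> 0 \<le> th x"
    and H: "\<And>x. x \<in> G z \<Longrightarrow> hamiltonian lam mu c b (Dth x) < 0"
    and d: "d > 0" "\<And>x i. x \<in> G z \<Longrightarrow> i \<in> active x \<Longrightarrow> Dth x $ i \<le> - d"
    and x: "x \<in> closure (G z)"
  shows "W x \<le> th x"
proof -
  have "continuous_on (closure (G z)) th"
    using th unfolding C1_on_def by (intro has_derivative_continuous_on) auto
  then have "continuous_on (closure (G z)) (\<lambda>x. W x - th x)"
    using W unfolding viscosity_solution_def by (intro continuous_on_diff) auto
  then obtain y where y: "y \<in> closure (G z)" "\<And>x. x \<in> closure (G z) \<Longrightarrow> W x - th x \<le> W y - th y"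
    using continuous_attains_sup[OF compact_closure_G closure_G_nonempty] by blast
  have "y \<notin> G z"
  proof
    assume yG: "y \<in> G z"
    then have "local_max_on (G z) (\<lambda>x. W x - th x) y"
      using y closure_subset[of "G z"] by (auto simp: local_max_on_def intro!: exI[of _ 1])
    then have "0 \<le> max (ereal (hamiltonian lam mu c b (Dth y))) (SUP i\<in>active y. ereal (Dth y \<bullet> gam i))"
      by (rule viscosity_solution_local_max[OF W th yG])
    \<comment> \<open>A uniform \<open>d\<close> also covers an empty set of active indices, whose
      supremum is minus infinity.\<close>
    moreover have "(SUP i\<in>active y. ereal (Dth y \<bullet> gam i)) \<le> ereal (- d)"
      using d(2)[OF yG] by (intro SUP_least) (auto simp: gam_def inner_axis)
    moreover have "ereal (- d) < 0" using d by simp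
    ultimately show False
      using H[OF yG] by (auto simp: le_max_iff_disj dest: order_trans)
  qed
  then have yb: "y \<in> boundary_o z" using closure_G_cases y by blast
  then have "W y = 0" using W by (auto simp: viscosity_solution_def)
  then show ?thesis using y(2)[OF x] bd[OF yb] by simp
qed

text \<open>Here the supersolution property of \<open>W\<close> excludes a minimum point of
  \<open>W - th\<close> from \<open>G z\<close>.\<close>

lemma comparison_below:
  assumes W: "viscosity_solution lam mu c b z W"
    and th: "C1_on (closure (G z)) th Dth"
    and bd: "\<And>x. x \<in> boundary_o z \<Longrightarrow> th x \<le> 0"
    and H: "\<And>x. x \<in> G z \<Longrightarrow> 0 < hamiltonian lam mu c b (Dth x)"
    and d: "d > 0" "\<And>x i. x \<in> G z \<Longrightarrow> i \<in> active x \<Longrightarrow> d \<le> Dth x $ i"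
    and x: "x \<in> closure (G z)"
  shows "th x \<le> W x"
proof -
  have "continuous_on (closure (G z)) th"
    using th unfolding C1_on_def by (intro has_derivative_continuous_on) auto
  then have "continuous_on (closure (G z)) (\<lambda>x. W x - th x)"
    using W unfolding viscosity_solution_def by (intro continuous_on_diff) auto
  then obtain y where y: "y \<in> closure (G z)" "\<And>x. x \<in> closure (G z) \<Longrightarrow> W y - th y \<le> W x - th x"
    using continuous_attains_inf[OF compact_closure_G closure_G_nonempty] by blast
  have "y \<notin> G z"
  proof
    assume yG: "y \<in> G z"
    then have "local_min_on (G z) (\<lambda>x. W x - th x) y"
      using y closure_subset[of "G z"] by (auto simp: local_min_on_def intro!: exI[of _ 1])
    then have "min (ereal (hamiltonian lam mu c b (Dth y))) (INF i\<in>active y. ereal (Dth y \<bullet> gam i)) \<le> 0"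
      by (rule viscosity_solution_local_min[OF W th yG])
    moreover have "ereal d \<le> (INF i\<in>active y. ereal (Dth y \<bullet> gam i))"
      using d(2)[OF yG] by (intro INF_greatest) (auto simp: gam_def inner_axis)
    moreover have "0 < ereal d" using d by simp
    ultimately show False
      using H[OF yG] by (auto simp: min_le_iff_disj dest: order_trans)
  qed
  then have yb: "y \<in> boundary_o z" using closure_G_cases y by blast
  then have "W y = 0" using W by (auto simp: viscosity_solution_def)
  then show ?thesis using y(2)[OF x] bd[OF yb] by simp
qed

text \<open>Piece \<open>i\<close> is tilted by \<open>e\<close> times the sum of the distances to
  the outer faces. The tilt is nonnegative on the closure and lowers every partial derivative by
  \<open>e\<close>, giving strictness both in the Hamiltonian and on the reflecting faces. Then
  \<open>e\<close> tends to 0.\<close>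

lemma viscosity_solution_le:
  assumes W: "viscosity_solution lam mu c b z W" and b: "b \<ge> rate_bound"
    and x: "x \<in> closure (G z)"
  shows "W x \<le> V x"
proof (rule V_ge)
  fix i
  let ?th = "\<lambda>e x. al $ i * (z $ i - x $ i) + e * (\<Sum>j\<in>UNIV. z $ j - x $ j)"
  have "W x \<le> ?th e x" if e: "0 < e" "e < 1" for e
  proof (rule comparison_above[OF W])
    let ?D = "\<lambda>x :: real ^ 'n. (\<chi> j. - (if j = i then al $ i else 0) - e) :: real ^ 'n"
    have inner: "?D y \<bullet> h = - al $ i * h $ i - e * (\<Sum>j\<in>UNIV. h $ j)" for y h :: "real ^ 'n"
      by (simp add: inner_vec_def left_diff_distrib sum_subtractf sum_distrib_left
            if_distrib[of "\<lambda>x. x * _"] if_distrib[of uminus] cong: if_cong)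
    have "(?th e has_derivative (\<lambda>h. - al $ i * h $ i - e * (\<Sum>j\<in>UNIV. h $ j))) (at y within S)" for y S
      by (auto intro!: derivative_eq_intros bounded_linear_imp_has_derivative[OF bounded_linear_vec_nth]
          simp: sum_negf algebra_simps)
    then show "C1_on (closure (G z)) (?th e) ?D"
      unfolding C1_on_def inner by (simp add: continuous_on_const)
    show "0 \<le> ?th e y" if "y \<in> boundary_o z" for y
      using closure_G[OF boundary_o_face(1)[OF that]] al e
      by (intro add_nonneg_nonneg mult_nonneg_nonneg sum_nonneg) (auto simp: less_imp_le)
    show "hamiltonian lam mu c b (?D y) < 0" for y
      using hamiltonian_axis_le[OF b, of e i] e by simp
    show "0 < e" by fact
    show "?D y $ j \<le> - e" for y j using al[of i] by auto
  qed fact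
  then have "\<forall>\<^sub>F e in at_right 0. W x \<le> ?th e x"
    unfolding eventually_at_right_field by (intro exI[of _ 1]) simp
  moreover have "((\<lambda>e. ?th e x) \<longlongrightarrow> ?th 0 x) (at_right 0)"
    by (intro tendsto_intros)
  ultimately show "W x \<le> al $ i * (z $ i - x $ i)"
    using tendsto_lowerbound[of "\<lambda>e. ?th e x" "?th 0 x" "at_right 0" "W x"] by simp
qed

text \<open>\<open>V\<close> is smoothed by a soft minimum. Replacing \<open>x\<^sub>i\<close> by \<open>sqrt (x\<^sub>i\<^sup>2 + e\<^sup>2)\<close> makes the normal derivative
  vanish on the reflecting faces, and the linear term then makes it positive there.\<close>

lemma viscosity_solution_ge_smoothed:
  assumes W: "viscosity_solution lam mu c b z W" and b: "b \<ge> 0"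
    and x: "x \<in> closure (G z)" and e: "0 < e" "e < 1"
  defines "d \<equiv> ln (1 + e / (1 + sum_mu))"
  shows "- e * ln (\<Sum>i\<in>UNIV. exp (- ((1 - e) * al $ i * (z $ i - sqrt ((x $ i)\<^sup>2 + e\<^sup>2))) / e))
         - d * (\<Sum>j\<in>UNIV. z $ j - x $ j) \<le> W x"
proof -
  define E where "E i x = exp (- ((1 - e) * al $ i * (z $ i - sqrt ((x $ i)\<^sup>2 + e\<^sup>2))) / e)"
    for i and x :: "real ^ 'n"
  define S where "S x = (\<Sum>i\<in>UNIV. E i x)" for x
  \<comment> \<open>The soft minimum weights \<open>E i x / S x\<close> sum to 1; the factor
    \<open>1 - e\<close> leaves the slack needed for strictness, and the last factor is the
    derivative of the square root.\<close>
  define w where "w x i = (1 - e) * (E i x / S x) * (x $ i / sqrt ((x $ i)\<^sup>2 + e\<^sup>2))" for x i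
  define D where "D x = (\<chi> i. d - w x i * al $ i)" for x
  define th where "th x = - e * ln (S x) - d * (\<Sum>j\<in>UNIV. z $ j - x $ j)" for x
  have E: "E i x > 0" for i x by (simp add: E_def)
  have S: "S x > 0" for x unfolding S_def by (intro sum_pos E) auto
  have E_le: "E i x \<le> S x" for i x
    unfolding S_def by (rule member_le_sum) (auto simp: E less_imp_le)
  have sq: "(x $ i)\<^sup>2 + e\<^sup>2 > 0" for i and x :: "real ^ 'n"
    using e by (simp add: add_nonneg_pos)
  \<comment> \<open>The logarithm in \<open>d\<close> gives \<open>sum_mu * (exp d - 1) < e\<close>,
    so the shift by \<open>d\<close> uses less than the slack of the weights.\<close>
  have quot: "e / (1 + sum_mu) > 0" using e sum_mu_nonneg by simp
  then have d: "d > 0" "exp d - 1 = e / (1 + sum_mu)" by (simp_all add: d_def)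
  have "th x \<le> W x"
  proof (rule comparison_below[OF W])
    have derE: "(E i has_derivative (\<lambda>h. E i y * ((1 - e) * al $ i * (y $ i / sqrt ((y $ i)\<^sup>2 + e\<^sup>2)) / e) * h $ i))
        (at y within T)" for i y T
      unfolding E_def using sq[of y i] e
      by (auto intro!: derivative_eq_intros bounded_linear_imp_has_derivative[OF bounded_linear_vec_nth]
          simp: field_simps)
    have derS: "(S has_derivative (\<lambda>h. \<Sum>i\<in>UNIV. E i y * ((1 - e) * al $ i * (y $ i / sqrt ((y $ i)\<^sup>2 + e\<^sup>2)) / e) * h $ i))
        (at y within T)" for y T
      unfolding S_def by (intro has_derivative_sum derE)
    \<comment> \<open>Isolated for a single coordinate: the \<open>e\<close> of the soft minimum
      cancels the \<open>1 / e\<close> of its exponents.\<close>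
    have deriv_term: "- e * (k * ((1 - e) * a * q / e) * h / s) + d * h = (d - (1 - e) * (k / s) * q * a) * h"
      if "s > 0" for k a q h s :: real
      using e that by (simp add: field_simps)
    have "(th has_derivative (\<lambda>h. D y \<bullet> h)) (at y within T)" for y T
    proof -
      have "(th has_derivative (\<lambda>h. - e * ((\<Sum>i\<in>UNIV. E i y * ((1 - e) * al $ i * (y $ i / sqrt ((y $ i)\<^sup>2 + e\<^sup>2)) / e) * h $ i) / S y)
            + d * (\<Sum>i\<in>UNIV. h $ i))) (at y within T)"
        unfolding th_def using S[of y]
        by (auto intro!: derivative_eq_intros derS bounded_linear_imp_has_derivative[OF bounded_linear_vec_nth]
            simp: sum_negf divide_inverse)
      moreover have "- e * ((\<Sum>i\<in>UNIV. E i y * ((1 - e) * al $ i * (y $ i / sqrt ((y $ i)\<^sup>2 + e\<^sup>2)) / e) * h $ i) / S y)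
            + d * (\<Sum>i\<in>UNIV. h $ i) = D y \<bullet> h" for h
        unfolding inner_vec_def sum_divide_distrib sum_distrib_left sum.distrib[symmetric]
      proof (intro sum.cong refl)
        show "- e * (E i y * ((1 - e) * al $ i * (y $ i / sqrt ((y $ i)\<^sup>2 + e\<^sup>2)) / e) * h $ i / S y)
            + d * h $ i = D y $ i \<bullet> h $ i" for i
          using deriv_term[OF S[of y], of "E i y" "al $ i" "y $ i / sqrt ((y $ i)\<^sup>2 + e\<^sup>2)" "h $ i"]
          by (simp add: D_def w_def)
      qed
      ultimately show ?thesis by simp
    qed
    moreover have "continuous_on T (E i)" for T i
      unfolding E_def using e by (auto intro!: continuous_intros)
    then have "continuous_on T (\<lambda>y. w y i)" for T i
      unfolding w_def S_def using S[unfolded S_def] sq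
      by (intro continuous_intros) (auto simp: less_imp_neq[symmetric])
    then have "continuous_on T D" for T
      unfolding D_def by (intro continuous_intros)
    ultimately show "C1_on (closure (G z)) th D" by (simp add: C1_on_def)
    show "th y \<le> 0" if yb: "y \<in> boundary_o z" for y
    proof -
      \<comment> \<open>On an outer face some exponent is nonnegative, as the square root is at
        least \<open>y $ i = z $ i\<close>; so \<open>S y >= 1\<close> and the soft minimum is
        nonpositive.\<close>
      obtain i where i: "y $ i = z $ i" using boundary_o_face(2)[OF yb] by blast
      have "y $ i \<le> sqrt ((y $ i)\<^sup>2 + e\<^sup>2)" by (rule real_le_rsqrt) simp
      then have "(1 - e) * al $ i * (z $ i - sqrt ((y $ i)\<^sup>2 + e\<^sup>2)) \<le> 0"
        using i e al[of i] by (intro mult_nonneg_nonpos) auto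
      then have "1 \<le> E i y" using e by (simp add: E_def divide_nonpos_pos)
      then have "0 \<le> ln (S y)" using E_le[of i y] by simp
      moreover have "0 \<le> (\<Sum>j\<in>UNIV. z $ j - y $ j)"
        using closure_G[OF boundary_o_face(1)[OF yb]] by (intro sum_nonneg) auto
      ultimately have "0 \<le> e * ln (S y)" "0 \<le> d * (\<Sum>j\<in>UNIV. z $ j - y $ j)"
        using e d by auto
      then show ?thesis by (simp add: th_def)
    qed
    show "0 < hamiltonian lam mu c b (D y)" if y: "y \<in> G z" for y
    proof -
      have y0: "0 \<le> y $ i" for i using y by (simp add: G_def)
      have s: "0 \<le> y $ i / sqrt ((y $ i)\<^sup>2 + e\<^sup>2)" "y $ i / sqrt ((y $ i)\<^sup>2 + e\<^sup>2) \<le> 1" for i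
        using y0[of i] sq[of y i] real_le_rsqrt[of "y $ i" "(y $ i)\<^sup>2 + e\<^sup>2"] by auto
      have frac: "0 \<le> E i y / S y" for i using E[of i y] S[of y] by simp
      have w: "0 \<le> w y i" for i
        unfolding w_def using s frac e by (intro mult_nonneg_nonneg) auto
      have "(\<Sum>i\<in>UNIV. w y i) \<le> (\<Sum>i\<in>UNIV. (1 - e) * (E i y / S y) * 1)"
        unfolding w_def using s frac e by (intro sum_mono mult_left_mono mult_nonneg_nonneg) auto
      also have "\<dots> = (1 - e) * ((\<Sum>i\<in>UNIV. E i y) / S y)"
        by (simp add: sum_distrib_left sum_divide_distrib)
      also have "\<dots> = 1 - e" using S[of y] by (simp add: S_def)
      finally have "e - sum_mu * (exp d - 1) \<le> hamiltonian lam mu c b (D y)"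
        unfolding D_def using e d w by (intro hamiltonian_mixture_ge[OF b]) auto
      moreover have "sum_mu * (exp d - 1) < e"
        unfolding d using e sum_mu_nonneg by (simp add: field_simps add_nonneg_pos)
      ultimately show ?thesis by simp
    qed
    show "0 < d" by (rule d)
    \<comment> \<open>On a reflecting face the factor \<open>y $ i\<close> removes the weight and
      leaves exactly \<open>d\<close>.\<close>
    show "d \<le> D y $ i" if "i \<in> active y" for y i
      using that by (simp add: D_def w_def active_def)
  qed fact
  then show ?thesis by (simp add: th_def S_def E_def)
qed

text \<open>The smoothing errors are explicit: the soft minimum costs \<open>e\<close> times the
  logarithm of the number of classes, \<open>sqrt (t^2 + e^2) <= t + e\<close> for
  \<open>t >= 0\<close> costs at most \<open>?s * e\<close>, and \<open>d <= e\<close>.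
  \<open>?f\<close> collects them and tends to \<open>V x\<close>.\<close>

lemma viscosity_solution_ge:
  assumes W: "viscosity_solution lam mu c b z W" and b: "b \<ge> 0"
    and x: "x \<in> closure (G z)"
  shows "V x \<le> W x"
proof -
  let ?s = "\<Sum>i\<in>UNIV. al $ i"
  let ?Z = "\<Sum>j\<in>UNIV. z $ j - x $ j"
  let ?f = "\<lambda>e. (1 - e) * (V x - ?s * e) - e * ln (real CARD('n)) - e * ?Z"
  have "?f e \<le> W x" if e: "0 < e" "e < 1" for e
  proof -
    define d where "d = ln (1 + e / (1 + sum_mu))"
    let ?E = "\<lambda>i. exp (- ((1 - e) * al $ i * (z $ i - sqrt ((x $ i)\<^sup>2 + e\<^sup>2))) / e)"
    let ?r = "(1 - e) * (V x - ?s * e)"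
    have "?E i \<le> exp (- ?r / e)" for i
    proof -
      have "sqrt ((x $ i)\<^sup>2 + e\<^sup>2) \<le> x $ i + e"
        using closure_G[OF x, of i] e by (intro real_le_lsqrt) (auto simp: power2_sum)
      then have "al $ i * (z $ i - x $ i - e) \<le> al $ i * (z $ i - sqrt ((x $ i)\<^sup>2 + e\<^sup>2))"
        using al[of i] by (intro mult_left_mono) auto
      moreover have "al $ i * e \<le> ?s * e"
        using al e by (intro mult_right_mono member_le_sum) (auto simp: less_imp_le)
      ultimately have "V x - ?s * e \<le> al $ i * (z $ i - sqrt ((x $ i)\<^sup>2 + e\<^sup>2))"
        using V_le[of x i] by (simp add: algebra_simps)
      then have "?r \<le> (1 - e) * (al $ i * (z $ i - sqrt ((x $ i)\<^sup>2 + e\<^sup>2)))"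
        using e by (intro mult_left_mono) auto
      then show ?thesis using e by (simp add: divide_le_cancel mult.assoc)
    qed
    then have "(\<Sum>i\<in>UNIV. ?E i) \<le> real CARD('n) * exp (- ?r / e)"
      using sum_bounded_above[of UNIV ?E "exp (- ?r / e)"] by simp
    moreover have "0 < (\<Sum>i\<in>UNIV. ?E i)" by (intro sum_pos) auto
    ultimately have "ln (\<Sum>i\<in>UNIV. ?E i) \<le> ln (real CARD('n) * exp (- ?r / e))"
      by (subst ln_le_cancel_iff) auto
    also have "\<dots> = ln (real CARD('n)) - ?r / e"
      by (subst ln_mult) auto
    finally have "e * ln (\<Sum>i\<in>UNIV. ?E i) \<le> e * (ln (real CARD('n)) - ?r / e)"
      using e by (intro mult_left_mono) auto
    also have "\<dots> = e * ln (real CARD('n)) - ?r"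
      using e unfolding right_diff_distrib[of e] by simp
    finally have "e * ln (\<Sum>i\<in>UNIV. ?E i) \<le> e * ln (real CARD('n)) - ?r" .
    moreover have "d * ?Z \<le> e * ?Z"
    proof (rule mult_right_mono)
      have "d \<le> e / (1 + sum_mu)"
        unfolding d_def using e sum_mu_nonneg by (intro ln_add_one_self_le_self) auto
      also have "\<dots> \<le> e" using e sum_mu_nonneg by (simp add: divide_le_eq mult_le_cancel_left1)
      finally show "d \<le> e" .
      show "0 \<le> ?Z" using closure_G[OF x] by (intro sum_nonneg) auto
    qed
    ultimately show ?thesis
      using viscosity_solution_ge_smoothed[OF W b x e] unfolding d_def by linarith
  qed
  then have "\<forall>\<^sub>F e in at_right 0. ?f e \<le> W x"
    unfolding eventually_at_right_field by (intro exI[of _ 1]) simp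
  moreover have "(?f \<longlongrightarrow> ?f 0) (at_right 0)"
    by (intro tendsto_intros)
  ultimately show ?thesis
    using tendsto_upperbound[of ?f "?f 0" "at_right 0" "W x"] by simp
qed

end

theorem proposition1:
  fixes lam mu z :: "real ^ 'n::finite"
  assumes "\<And>i. lam $ i > 0" and "\<And>i. mu $ i > 0" and "\<And>i. z $ i > 0"
  shows "\<exists>c0. \<forall>c\<ge>c0. \<exists>\<alpha> :: real ^ 'n. (\<forall>i. \<alpha> $ i > 0) \<and>
    (\<exists>b0. \<forall>b\<ge>b0.
       viscosity_solution lam mu c b z (\<lambda>x. MIN i\<in>UNIV. \<alpha> $ i * (z $ i - x $ i)) \<and>
       (\<forall>W. viscosity_solution lam mu c b z W \<longrightarrow>
          (\<forall>x\<in>closure (G z). W x = (MIN i\<in>UNIV. \<alpha> $ i * (z $ i - x $ i)))))"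
proof (intro exI[of _ "1 + (\<Sum>i\<in>UNIV. lam $ i) + 3 * (\<Sum>i\<in>UNIV. mu $ i)"] allI impI)
  fix c assume c: "c \<ge> 1 + (\<Sum>i\<in>UNIV. lam $ i) + 3 * (\<Sum>i\<in>UNIV. mu $ i)"
  have "0 \<le> (\<Sum>i\<in>UNIV. lam $ i)" "0 \<le> (\<Sum>i\<in>UNIV. mu $ i)"
    using assms by (auto intro!: sum_nonneg simp: less_imp_le)
  then have "c > 0" using c by simp
  then have "\<forall>i. \<exists>a>0. lam $ i * (exp a - 1) = c + mu $ i * (1 - exp (- a))"
    using decay_rate_exists assms by blast
  then have "\<exists>a. \<forall>i. a i > 0 \<and> lam $ i * (exp (a i) - 1) = c + mu $ i * (1 - exp (- a i))"
    by (rule choice)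
  then obtain a where a: "\<And>i. a i > 0"
      "\<And>i. lam $ i * (exp (a i) - 1) = c + mu $ i * (1 - exp (- a i))"
    by blast
  interpret server lam mu z c "\<chi> i. a i"
    by unfold_locales (use assms a c in auto)
  show "\<exists>\<alpha> :: real ^ 'n. (\<forall>i. \<alpha> $ i > 0) \<and>
    (\<exists>b0. \<forall>b\<ge>b0.
       viscosity_solution lam mu c b z (\<lambda>x. MIN i\<in>UNIV. \<alpha> $ i * (z $ i - x $ i)) \<and>
       (\<forall>W. viscosity_solution lam mu c b z W \<longrightarrow>
          (\<forall>x\<in>closure (G z). W x = (MIN i\<in>UNIV. \<alpha> $ i * (z $ i - x $ i)))))"
  \<comment> \<open>The witness \<open>rate_bound\<close> for \<open>b0\<close> depends on
    \<open>c\<close> through the decay rates.\<close>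
  proof (intro exI[of _ "\<chi> i. a i"] conjI exI[of _ rate_bound])
    show "\<forall>i. (\<chi> i. a i) $ i > 0" using al by blast
    have "viscosity_solution lam mu c b z V \<and>
        (\<forall>W. viscosity_solution lam mu c b z W \<longrightarrow> (\<forall>x\<in>closure (G z). W x = V x))"
      if b: "b \<ge> rate_bound" for b
    proof (intro conjI allI impI ballI antisym)
      show "viscosity_solution lam mu c b z V" by (rule V_viscosity_solution[OF b])
      fix W x assume W: "viscosity_solution lam mu c b z W" and x: "x \<in> closure (G z)"
      show "W x \<le> V x" by (rule viscosity_solution_le[OF W b x])
      have "0 \<le> b" using b rate_bound_nonneg by simp
      then show "V x \<le> W x" by (rule viscosity_solution_ge[OF W _ x])
    qed
    then show "\<forall>b\<ge>rate_bound.
       viscosity_solution lam mu c b z (\<lambda>x. MIN i\<in>UNIV. (\<chi> i. a i) $ i * (z $ i - x $ i)) \<and>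
       (\<forall>W. viscosity_solution lam mu c b z W \<longrightarrow>
          (\<forall>x\<in>closure (G z). W x = (MIN i\<in>UNIV. (\<chi> i. a i) $ i * (z $ i - x $ i))))"
      unfolding V_def[abs_def] by blast
  qed
qed

end
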